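(* Let $\varphi:X\times X\to[0,\infty)$ be a function such that $$\lim_{m\to\infty}4^m\varphi\Big(\frac{x}{2^m},\frac{y}{2^m}\Big)=0=\lim_{m\to\infty}\frac{1}{16^m}\varphi(2^mx,2^my)$$ for all $x,y\in X$, and $$\sum_{i=1}^\infty 4^{pi}\varphi^p\Big(\frac{x}{2^i},\frac{y}{2^i}\Big)<\infty\qquad\text{and}\qquad \sum_{i=0}^\infty\frac{1}{16^{pi}}\varphi^p(2^ix,2^iy)<\infty$$ for all $x\in X$ and all $y\in\{x,2x,3x,nx,(n+1)x,(n-1)x,(n+2)x,(n-2)x,(n-3)x\}$. Suppose that a function $f:X\to Y$ with $f(0)=0$ satisfies $$\|\Delta f(x,y)\|_Y\le\varphi(x,y)\qquad\text{for all }x,y\in X.$$ Then there exist a unique quadratic function $Q:X\to Y$ and a unique quartic function $T:X\to Y$ such that $$\|f(x)-Q(x)-T(x)\|_Y\le\frac{M^9}{192}\Big(4[\widetilde\psi_q(x)]^{1/p}+[\widetilde\psi_t(x)]^{1/p}\Big)\qquad\text{for all }x\in X,$$ where $$\widetilde\psi_q(x)=\sum_{i=1}^\infty 4^{pi}\,\Theta_\varphi\Big(\frac{x}{2^i}\Big),\qquad \widetilde\psi_t(x)=\sum_{i=0}^\infty\frac{1}{16^{pi}}\,\Theta_\varphi(2^ix).$$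
   Context: Fix an integer $n\ne 0,\pm1$ and a real $p$ with $0<p\le1$. A quasi-norm on a real linear space $Z$ is a map $\|\cdot\|:Z\to\mathbb R$ with: $\|x\|\ge0$, and $\|x\|=0$ iff $x=0$; $\|\lambda x\|=|\lambda|\|x\|$ for $\lambda\in\mathbb R$; and there is a constant $K\ge1$ with $\|x+y\|\le K(\|x\|+\|y\|)$ for all $x,y$. The smallest such $K$ is the modulus of concavity. A quasi-Banach space is a complete quasi-normed space. A quasi-norm is a $p$-norm if $\|x+y\|^p\le\|x\|^p+\|y\|^p$ for all $x,y$, and a quasi-Banach space with a $p$-norm is a $p$-Banach space. $X$ is a quasi-Banach space with quasi-norm $\|\cdot\|_X$, $Y$ is a $p$-Banach space with $p$-norm $\|\cdot\|_Y$, and $M$ is the modulus of concavity of $\|\cdot\|_Y$. For $f:X\to Y$, $$\Delta f(x,y)=f(nx+y)+f(nx-y)-n^2f(x+y)-n^2f(x-y)-2f(nx)+2n^2f(x)+2(n^2-1)f(y).$$ A function $Q:X\to Y$ is quadratic if $Q(x+y)+Q(x-y)=2Q(x)+2Q(y)$ for all $x,y$. A function $T:X\to Y$ is quartic if $T(x+2y)+T(x-2y)=4(T(x+y)+T(x-y)+6T(y))-6T(x)$ for all $x,y$. Write $\varphi^p(x,y)=(\varphi(x,y))^p$ and $n^{2p}=(n^2)^p$. For $\varphi:X\times X\to[0,\infty)$ and $x\in X$ put $$\begin{aligned}\Theta_\varphi(x)=\frac{1}{n^{2p}(n^2-1)^p}\Big[&\varphi^p(x,(n+2)x)+\varphi^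p(x,(n-2)x)+4^p\varphi^p(x,(n+1)x)+4^p\varphi^p(x,(n-1)x)\\&+10^p\varphi^p(x,nx)+\varphi^p(2x,2x)+4^p\varphi^p(2x,x)+n^{2p}\varphi^p(x,3x)\\&+2^p(3n^2-1)^p\varphi^p(x,2x)+(17n^2-8)^p\varphi^p(x,x)\\&+\frac{n^{2p}}{(n^2-1)^p}\big(\varphi^p(0,(n+1)x)+\varphi^p(0,(n-3)x)+10^p\varphi^p(0,(n-1)x)+4^p\varphi^p(0,nx)+4^p\varphi^p(0,(n-2)x)\big)\\&+\frac{(n^4+1)^p}{(n^2-1)^p}\varphi^p(0,2x)+\frac{(2(3n^4-n^2+2))^p}{(n^2-1)^p}\varphi^p(0,x)\Big].\end{aligned}$$
   Formalization: The formal statement additionally assumes that the series defining ψ̃_q(x) and ψ̃_t(x) converge for every x; the listed summability conditions do not cover φ(0,kx) and φ(2x,x), and without this uniqueness can fail. *)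

theory Defs
  imports Complex_Main
begin

definition concavity_bound :: "('a::real_vector \<Rightarrow> real) \<Rightarrow> real \<Rightarrow> bool" where
  "concavity_bound N K \<longleftrightarrow> K \<ge> 1 \<and> (\<forall>x y. N (x + y) \<le> K * (N x + N y))"

definition quasi_norm :: "('a::real_vector \<Rightarrow> real) \<Rightarrow> bool" where
  "quasi_norm N \<longleftrightarrow>
     (\<forall>x. N x \<ge> 0) \<and> (\<forall>x. N x = 0 \<longleftrightarrow> x = 0) \<and>
     (\<forall>c x. N (c *\<^sub>R x) = \<bar>c\<bar> * N x) \<and>
     (\<exists>K. concavity_bound N K)"

definition modulus_of_concavity :: "('a::real_vector \<Rightarrow> real) \<Rightarrow> real" where
  "modulus_of_concavity N = (LEAST K. concavity_bound N K)"

text \<open>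
  A quasi-norm need not be a norm, so the metric of the class \<open>real_normed_vector\<close> is not
  available; Cauchy sequences and convergence are taken with respect to \<open>N\<close> itself.
\<close>
definition quasi_complete :: "('a::real_vector \<Rightarrow> real) \<Rightarrow> bool" where
  "quasi_complete N \<longleftrightarrow>
     (\<forall>s :: nat \<Rightarrow> 'a.
        (\<forall>e>0. \<exists>m. \<forall>i\<ge>m. \<forall>j\<ge>m. N (s i - s j) < e) \<longrightarrow>
        (\<exists>l. (\<lambda>k. N (s k - l)) \<longlonglongrightarrow> 0))"

definition quasi_Banach :: "('a::real_vector \<Rightarrow> real) \<Rightarrow> bool" where
  "quasi_Banach N \<longleftrightarrow> quasi_norm N \<and> quasi_complete N"

definition p_Banach :: "real \<Rightarrow> ('a::real_vector \<Rightarrow> real) \<Rightarrow> bool" where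
  "p_Banach p N \<longleftrightarrow>
     quasi_Banach N \<and> (\<forall>x y. N (x + y) powr p \<le> N x powr p + N y powr p)"

definition Delta ::
    "int \<Rightarrow> ('a::real_vector \<Rightarrow> 'b::real_vector) \<Rightarrow> 'a \<Rightarrow> 'a \<Rightarrow> 'b" where
  "Delta n f x y = (let r = real_of_int n in
       f (r *\<^sub>R x + y) + f (r *\<^sub>R x - y)
     - r^2 *\<^sub>R f (x + y) - r^2 *\<^sub>R f (x - y)
     - 2 *\<^sub>R f (r *\<^sub>R x) + (2 * r^2) *\<^sub>R f x + (2 * (r^2 - 1)) *\<^sub>R f y)"

definition quadratic :: "('a::real_vector \<Rightarrow> 'b::real_vector) \<Rightarrow> bool" where
  "quadratic Q \<longleftrightarrow> (\<forall>x y. Q (x + y) + Q (x - y) = 2 *\<^sub>R Q x + 2 *\<^sub>R Q y)"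

definition quartic :: "('a::real_vector \<Rightarrow> 'b::real_vector) \<Rightarrow> bool" where
  "quartic T \<longleftrightarrow>
     (\<forall>x y. T (x + 2 *\<^sub>R y) + T (x - 2 *\<^sub>R y)
        = 4 *\<^sub>R (T (x + y) + T (x - y) + 6 *\<^sub>R T y) - 6 *\<^sub>R T x)"

definition Theta ::
    "int \<Rightarrow> real \<Rightarrow> ('a::real_vector \<Rightarrow> 'a \<Rightarrow> real) \<Rightarrow> 'a \<Rightarrow> real" where
  "Theta n p \<phi> x = (let r = real_of_int n; \<Phi> = (\<lambda>u v. \<phi> u v powr p) in
     1 / ((r^2) powr p * (r^2 - 1) powr p) *
     ( \<Phi> x ((r + 2) *\<^sub>R x) + \<Phi> x ((r - 2) *\<^sub>R x)
     + 4 powr p * \<Phi> x ((r + 1) *\<^sub>R x) + 4 powr p * \<Phi> x ((r - 1) *\<^sub>R x)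
     + 10 powr p * \<Phi> x (r *\<^sub>R x)
     + \<Phi> (2 *\<^sub>R x) (2 *\<^sub>R x) + 4 powr p * \<Phi> (2 *\<^sub>R x) x
     + (r^2) powr p * \<Phi> x (3 *\<^sub>R x)
     + 2 powr p * (3 * r^2 - 1) powr p * \<Phi> x (2 *\<^sub>R x)
     + (17 * r^2 - 8) powr p * \<Phi> x x
     + (r^2) powr p / (r^2 - 1) powr p *
         ( \<Phi> 0 ((r + 1) *\<^sub>R x) + \<Phi> 0 ((r - 3) *\<^sub>R x)
         + 10 powr p * \<Phi> 0 ((r - 1) *\<^sub>R x)
         + 4 powr p * \<Phi> 0 (r *\<^sub>R x) + 4 powr p * \<Phi> 0 ((r - 2) *\<^sub>R x))
     + (r^4 + 1) powr p / (r^2 - 1) powr p * \<Phi> 0 (2 *\<^sub>R x)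
     + (2 * (3 * r^4 - r^2 + 2)) powr p / (r^2 - 1) powr p * \<Phi> 0 x))"

text \<open>
  The first of the following two series starts at \<open>i = 1\<close> in the mathematics, hence \<open>Suc i\<close>.
  Their convergence does not follow from summability of the powers of \<open>\<phi> x y\<close> for
  \<open>y\<close> in \<open>test_points n x\<close> (below), because \<open>Theta\<close> also involves \<open>\<phi> 0 (k *\<^sub>R x)\<close> and
  \<open>\<phi> (2 *\<^sub>R x) x\<close>; and \<open>psi_q\<close>, \<open>psi_t\<close> are meaningful only where the series converge.
\<close>
definition psi_q_term ::
    "int \<Rightarrow> real \<Rightarrow> ('a::real_vector \<Rightarrow> 'a \<Rightarrow> real) \<Rightarrow> 'a \<Rightarrow> nat \<Rightarrow> real" where
  "psi_q_term n p \<phi> x i = 4 powr (p * real (Suc i)) * Theta n p \<phi> (x /\<^sub>R 2 ^ Suc i)"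

definition psi_t_term ::
    "int \<Rightarrow> real \<Rightarrow> ('a::real_vector \<Rightarrow> 'a \<Rightarrow> real) \<Rightarrow> 'a \<Rightarrow> nat \<Rightarrow> real" where
  "psi_t_term n p \<phi> x i = 1 / 16 powr (p * real i) * Theta n p \<phi> (2 ^ i *\<^sub>R x)"

definition psi_q ::
    "int \<Rightarrow> real \<Rightarrow> ('a::real_vector \<Rightarrow> 'a \<Rightarrow> real) \<Rightarrow> 'a \<Rightarrow> real" where
  "psi_q n p \<phi> x = (\<Sum>i. psi_q_term n p \<phi> x i)"

definition psi_t ::
    "int \<Rightarrow> real \<Rightarrow> ('a::real_vector \<Rightarrow> 'a \<Rightarrow> real) \<Rightarrow> 'a \<Rightarrow> real" where
  "psi_t n p \<phi> x = (\<Sum>i. psi_t_term n p \<phi> x i)"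

definition test_points :: "int \<Rightarrow> 'a::real_vector \<Rightarrow> 'a set" where
  "test_points n x = (let r = real_of_int n in
     {x, 2 *\<^sub>R x, 3 *\<^sub>R x, r *\<^sub>R x, (r + 1) *\<^sub>R x, (r - 1) *\<^sub>R x,
      (r + 2) *\<^sub>R x, (r - 2) *\<^sub>R x, (r - 3) *\<^sub>R x})"

end

theory Submission
  imports Defs
begin

text \<open>
  The equation \<open>Delta n F = 0\<close> says that the quadratic defect \<open>B(x,y) = F(x+y) + F(x-y) - 2F(x) - 2F(y)\<close>
  satisfies \<open>B(nx,y) = n\<^sup>2 B(x,y)\<close>. This forces \<open>B\<close> to be quadratic in each variable, so that \<open>F\<close> is
  quadratic if \<open>F(2x) = 4F(x)\<close> and quartic if \<open>F(2x) = 16F(x)\<close>.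
  An explicit combination of values of \<open>Delta n f\<close> bounds \<open>f(4x) - 20f(2x) + 64f(x)\<close> by
  \<open>Theta\<close>. Since \<open>z\<^sup>2 - 20z + 64 = (z - 4)(z - 16)\<close>, the functions \<open>g(x) = f(2x) - 16f(x)\<close> and
  \<open>h(x) = f(2x) - 4f(x)\<close> approximately satisfy \<open>g(2x) = 4g(x)\<close> and \<open>h(2x) = 16h(x)\<close>; the limits of
  \<open>4\<^sup>m g(x/2\<^sup>m)\<close> and \<open>h(2\<^sup>m x)/16\<^sup>m\<close> give \<open>Q\<close> and \<open>T\<close>, because \<open>12f = h - g\<close>.
  For uniqueness, the error bound tends to 0 under both rescalings, which isolates first the
  quadratic and then the quartic part of a difference of two solutions.
\<close>

subsection \<open>Exact solutions\<close>

text \<open>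
  The simplifier does not collect symbolic coefficients of vectors; after applying a functional
  the identity is one of real polynomials.
\<close>
lemma eq_if_linear_functionals_eq:
  fixes u v :: "'b::real_vector"
  assumes "\<And>L :: 'b \<Rightarrow> real. linear L \<Longrightarrow> L u = L v"
  shows "u = v"
proof (rule ccontr)
  assume "u \<noteq> v"
  then have "independent {u - v}" by (simp add: dependent_single)
  then obtain L :: "'b \<Rightarrow> real" where L: "linear L" "\<forall>x\<in>{u - v}. L x = 1"
    using linear_independent_extend[of "{u - v}" "\<lambda>_. 1"] by blast
  then show False using assms[OF L(1)] by (simp add: linear_diff)
qed

lemmas linear_distribs = linear_add linear_diff linear_neg linear_scale linear_0

definition quadratic_defect :: "('a::real_vector \<Rightarrow> 'b::real_vector) \<Rightarrow> 'a \<Rightarrow> 'a \<Rightarrow> 'b" where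
  "quadratic_defect F x y = F (x + y) + F (x - y) - 2 *\<^sub>R F x - 2 *\<^sub>R F y"

lemma quadratic_iff_defect_zero: "quadratic F \<longleftrightarrow> (\<forall>x y. quadratic_defect F x y = 0)"
  by (simp add: quadratic_def quadratic_defect_def diff_diff_eq)

lemma Delta_eq_defect:
  "Delta n F x y = quadratic_defect F (real_of_int n *\<^sub>R x) y
     - (real_of_int n)\<^sup>2 *\<^sub>R quadratic_defect F x y"
  by (simp add: Delta_def quadratic_defect_def Let_def algebra_simps)

text \<open>At \<open>x = 0\<close> all terms collapse to the odd part of \<open>F\<close>. For
  exact solutions this yields evenness; for approximate ones it lets \<open>\<phi> 0 y\<close> pay
  for the failure of evenness, which explains the \<open>\<Phi> 0\<close> terms in
  \<open>Theta\<close>.\<close>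

lemma Delta_0_left:
  assumes "F 0 = 0"
  shows "Delta n F 0 y = ((real_of_int n)\<^sup>2 - 1) *\<^sub>R (F y - F (- y))"
  using assms
  by - (rule eq_if_linear_functionals_eq, simp add: Delta_def Let_def linear_distribs algebra_simps)

lemma int_square_gt_1:
  assumes "n \<noteq> 0" "n \<noteq> 1" "n \<noteq> -1"
  shows "(real_of_int n)\<^sup>2 > 1"
proof -
  have "\<bar>n\<bar> > 1" using assms by linarith
  then have "\<bar>real_of_int n\<bar> > 1" by linarith
  then show ?thesis by (metis one_less_power power2_abs zero_less_numeral)
qed

text \<open>Evenness of \<open>F\<close> makes the defect symmetric, and makes the defect of the
  defect symmetric in three arguments. Two counts of the powers of \<open>r^2\<close> produced by
  scaling then disagree unless it vanishes, because \<open>r^2 > 1\<close>.\<close>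

lemma Delta_zero_defect_quadratic:
  fixes F :: "'a::real_vector \<Rightarrow> 'b::real_vector"
  assumes n: "n \<noteq> 0" "n \<noteq> 1" "n \<noteq> -1"
    and Delta: "\<And>x y. Delta n F x y = 0" and F0: "F 0 = 0"
  shows "quadratic (\<lambda>x. quadratic_defect F x y)"
    and "quadratic_defect F y x = quadratic_defect F x y"
proof -
  define r where "r = real_of_int n"
  have r2: "r\<^sup>2 > 1" using int_square_gt_1[OF n] by (simp add: r_def)
  have even: "F (- y) = F y" for y
    using Delta_0_left[of F n y] F0 Delta[of 0 y] r2 by (simp add: r_def)
  define B where "B = quadratic_defect F"
  have ev2: "F (y - x) = F (x - y)" for x y by (metis even minus_diff_eq)
  have B_sym: "B x y = B y x" for x y
    by (simp add: B_def quadratic_defect_def ev2[of y x] add.commute)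
  then show "quadratic_defect F y x = quadratic_defect F x y" by (simp add: B_def)
  have B_even: "B (- x) y = B x y" for x y
  proof -
    have "F (- x + y) = F (x - y)" by (metis even minus_diff_eq uminus_add_conv_diff)
    moreover have "F (- x - y) = F (x + y)" by (metis even minus_add_distrib add_uminus_conv_diff)
    ultimately show ?thesis by (simp add: B_def quadratic_defect_def even)
  qed
  have B_hom: "B (r *\<^sub>R x) y = r\<^sup>2 *\<^sub>R B x y" for x y
    using Delta_eq_defect[of n F x y] Delta[of x y] by (simp add: B_def r_def)
  \<comment> \<open>\<open>C\<close> is totally symmetric. Scaling its middle argument by \<open>r\<close> multiplies it by \<open>r\<^sup>2\<close>, hence so does
    scaling any single argument; but scaling both outer arguments also gives only \<open>r\<^sup>2\<close>.\<close>
  define C where "C x y z = quadratic_defect (\<lambda>x. B x y) x z" for x y z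
  have C_hom2: "C x (r *\<^sub>R y) z = r\<^sup>2 *\<^sub>R C x y z" for x y z
  proof -
    have "B u (r *\<^sub>R y) = r\<^sup>2 *\<^sub>R B u y" for u by (metis B_sym B_hom)
    then show ?thesis by (simp add: C_def quadratic_defect_def algebra_simps)
  qed
  have C_hom13: "C (r *\<^sub>R x) y (r *\<^sub>R z) = r\<^sup>2 *\<^sub>R C x y z" for x y z
  proof -
    have "B (r *\<^sub>R x + r *\<^sub>R z) y = r\<^sup>2 *\<^sub>R B (x + z) y" "B (r *\<^sub>R x - r *\<^sub>R z) y = r\<^sup>2 *\<^sub>R B (x - z) y"
      by (metis B_hom scaleR_add_right) (metis B_hom scaleR_diff_right)
    then show ?thesis by (simp add: C_def quadratic_defect_def B_hom algebra_simps)
  qed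
  have C_swap23: "C x y z = C x z y" for x y z
    by (simp add: C_def B_def quadratic_defect_def ev2[of z y] algebra_simps)
      (rule eq_if_linear_functionals_eq, simp add: linear_distribs)
  have C_swap13: "C x y z = C z y x" for x y z
    using B_even[of "x - z" y] by (simp add: C_def quadratic_defect_def algebra_simps)
  have "C x y z = 0" for x y z
  proof -
    have "r\<^sup>2 *\<^sub>R C x y z = C (r *\<^sub>R x) y (r *\<^sub>R z)" by (simp add: C_hom13)
    also have "\<dots> = r\<^sup>2 *\<^sub>R C (r *\<^sub>R x) z y" by (metis C_swap23 C_hom2)
    also have "\<dots> = r\<^sup>2 *\<^sub>R r\<^sup>2 *\<^sub>R C x y z" by (metis C_swap23 C_swap13 C_hom2)
    finally have "(r\<^sup>2 * r\<^sup>2 - r\<^sup>2) *\<^sub>R C x y z = 0" by (simp only: scaleR_diff_left scaleR_scaleR) simp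
    moreover have "r\<^sup>2 * r\<^sup>2 - r\<^sup>2 \<noteq> 0"
      using r2 less_1_mult[OF r2 r2] mult_strict_right_mono[OF r2, of "r\<^sup>2"] by linarith
    ultimately show ?thesis by (simp only: scaleR_eq_0_iff) auto
  qed
  then show "quadratic (\<lambda>x. quadratic_defect F x y)"
    by (simp add: quadratic_iff_defect_zero C_def B_def)
qed

lemma quadratic_0:
  assumes "quadratic Q"
  shows "Q 0 = 0"
proof -
  have "Q (0 + 0) + Q (0 - 0) = 2 *\<^sub>R Q 0 + 2 *\<^sub>R Q 0"
    using assms unfolding quadratic_def by blast
  then have "2 *\<^sub>R Q 0 = 0" by (simp add: scaleR_2)
  then show ?thesis by simp
qed

lemma quadratic_double:
  assumes "quadratic Q"
  shows "Q (2 *\<^sub>R x) = 4 *\<^sub>R Q x"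
proof -
  have "Q (x + x) + Q (x - x) = 2 *\<^sub>R Q x + 2 *\<^sub>R Q x"
    using assms unfolding quadratic_def by blast
  then show ?thesis
    using quadratic_0[OF assms] by (simp flip: scaleR_2)
qed

lemma Delta_zero_defect_double:
  assumes n: "n \<noteq> 0" "n \<noteq> 1" "n \<noteq> -1"
    and Delta: "\<And>x y. Delta n F x y = 0" and F0: "F 0 = 0"
  shows "quadratic_defect F x (2 *\<^sub>R y) = 4 *\<^sub>R quadratic_defect F x y"
    and "quadratic_defect F (2 *\<^sub>R x) y = 4 *\<^sub>R quadratic_defect F x y"
proof -
  note defect = Delta_zero_defect_quadratic[OF assms]
  have double_left: "quadratic_defect F (2 *\<^sub>R u) v = 4 *\<^sub>R quadratic_defect F u v" for u v
    by (rule quadratic_double[OF defect(1)])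
  then show "quadratic_defect F (2 *\<^sub>R x) y = 4 *\<^sub>R quadratic_defect F x y" .
  show "quadratic_defect F x (2 *\<^sub>R y) = 4 *\<^sub>R quadratic_defect F x y"
    unfolding defect(2)[of x] by (rule double_left)
qed

lemma scaled_double_0:
  fixes F :: "'a::real_vector \<Rightarrow> 'b::real_vector"
  assumes "F (2 *\<^sub>R 0) = c *\<^sub>R F 0" "c \<noteq> 1"
  shows "F 0 = 0"
proof -
  have "(c - 1) *\<^sub>R F 0 = c *\<^sub>R F 0 - F 0" by (simp add: scaleR_diff_left)
  also have "\<dots> = 0" by (simp flip: assms(1))
  finally have "(c - 1) *\<^sub>R F 0 = 0" .
  then show ?thesis using assms(2) by simp
qed

text \<open>Doubling both arguments multiplies the defect by 16, since it is quadratic in each, but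
  only by 4, since \<open>F\<close> itself scales by 4. So the defect is zero.\<close>

lemma Delta_zero_imp_quadratic:
  assumes n: "n \<noteq> 0" "n \<noteq> 1" "n \<noteq> -1"
    and Delta: "\<And>x y. Delta n F x y = 0" and double: "\<And>x. F (2 *\<^sub>R x) = 4 *\<^sub>R F x"
  shows "quadratic F"
proof -
  have F0: "F 0 = 0" by (rule scaled_double_0[of F 4, OF double]) simp
  note dbl = Delta_zero_defect_double[OF n Delta F0]
  have "quadratic_defect F x y = 0" for x y
  proof -
    have "quadratic_defect F (2 *\<^sub>R x) (2 *\<^sub>R y) = 4 *\<^sub>R quadratic_defect F x y"
    proof -
      have "F (2 *\<^sub>R x + 2 *\<^sub>R y) = 4 *\<^sub>R F (x + y)" "F (2 *\<^sub>R x - 2 *\<^sub>R y) = 4 *\<^sub>R F (x - y)"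
        by (metis double scaleR_add_right) (metis double scaleR_diff_right)
      then show ?thesis by (simp add: quadratic_defect_def double scaleR_add_right scaleR_diff_right)
    qed
    then have "4 *\<^sub>R 4 *\<^sub>R quadratic_defect F x y = 4 *\<^sub>R quadratic_defect F x y" by (simp only: dbl)
    then have "(16 - 4::real) *\<^sub>R quadratic_defect F x y = 0" by (simp only: scaleR_diff_left) simp
    then show ?thesis by simp
  qed
  then show ?thesis by (simp add: quadratic_iff_defect_zero)
qed

text \<open>Written out with \<open>F (2y) = 16 F y\<close>, the scaling of the defect by 4 when its
  second argument is doubled is exactly the quartic equation.\<close>

lemma Delta_zero_imp_quartic:
  assumes n: "n \<noteq> 0" "n \<noteq> 1" "n \<noteq> -1"
    and Delta: "\<And>x y. Delta n F x y = 0" and double: "\<And>x. F (2 *\<^sub>R x) = 16 *\<^sub>R F x"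
  shows "quartic F"
  unfolding quartic_def
proof (intro allI)
  fix x y
  have F0: "F 0 = 0" by (rule scaled_double_0[of F 16, OF double]) simp
  have "quadratic_defect F x (2 *\<^sub>R y) = 4 *\<^sub>R quadratic_defect F x y"
    by (rule Delta_zero_defect_double[OF n Delta F0])
  then show "F (x + 2 *\<^sub>R y) + F (x - 2 *\<^sub>R y) = 4 *\<^sub>R (F (x + y) + F (x - y) + 6 *\<^sub>R F y) - 6 *\<^sub>R F x"
    unfolding quadratic_defect_def double
    by - (rule eq_if_linear_functionals_eq, drule_tac f = L in arg_cong, simp add: linear_distribs)
qed

lemma quartic_double:
  assumes "quartic T"
  shows "T (2 *\<^sub>R x) = 16 *\<^sub>R T x"
proof -
  have T: "T (x + 2 *\<^sub>R y) + T (x - 2 *\<^sub>R y) = 4 *\<^sub>R (T (x + y) + T (x - y) + 6 *\<^sub>R T y) - 6 *\<^sub>R T x" for x y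
    using assms unfolding quartic_def by blast
  have "24 *\<^sub>R T 0 = 0"
    using T[of 0 0] by - (rule eq_if_linear_functionals_eq, drule_tac f = L in arg_cong, simp add: linear_distribs)
  then have T0: "T 0 = 0" by simp
  \<comment> \<open>For \<open>x = 0\<close> the left side of the quartic equation is even in
    \<open>y\<close>, while the right side is \<open>28 T y + 4 T (-y)\<close>; comparing
    \<open>y\<close> with \<open>-y\<close> gives evenness.\<close>
  have T_even: "T (- x) = T x" using T[of 0 x] T[of 0 "-x"] by (simp add: algebra_simps T0)
  have "T (2 *\<^sub>R x) + T (2 *\<^sub>R (- x)) = 32 *\<^sub>R T x"
    using T[of 0 x] by (simp add: T0 T_even algebra_simps flip: scaleR_left_distrib)
  moreover have "T (2 *\<^sub>R (- x)) = T (2 *\<^sub>R x)"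
    using T[of 0 "2 *\<^sub>R x"] T[of 0 "- 2 *\<^sub>R x"] by (simp add: algebra_simps T0)
  ultimately have "2 *\<^sub>R T (2 *\<^sub>R x) = 2 *\<^sub>R 16 *\<^sub>R T x" by (simp add: scaleR_2)
  then show ?thesis by (simp only: scaleR_cancel_left) simp
qed

section \<open>Linear combinations of quadratic and of quartic maps\<close>

lemma quadratic_scaleR: "quadratic Q \<Longrightarrow> quadratic (\<lambda>x. c *\<^sub>R Q x)"
  unfolding quadratic_def by (metis scaleR_add_right scaleR_left_commute)

lemma quartic_scaleR:
  assumes "quartic T"
  shows "quartic (\<lambda>x. c *\<^sub>R T x)"
  unfolding quartic_def
proof (intro allI)
  fix x y
  have "c *\<^sub>R (T (x + 2 *\<^sub>R y) + T (x - 2 *\<^sub>R y))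
      = c *\<^sub>R (4 *\<^sub>R (T (x + y) + T (x - y) + 6 *\<^sub>R T y) - 6 *\<^sub>R T x)"
    using assms unfolding quartic_def by simp
  then show "c *\<^sub>R T (x + 2 *\<^sub>R y) + c *\<^sub>R T (x - 2 *\<^sub>R y)
      = 4 *\<^sub>R (c *\<^sub>R T (x + y) + c *\<^sub>R T (x - y) + 6 *\<^sub>R c *\<^sub>R T y) - 6 *\<^sub>R c *\<^sub>R T x"
    by (simp add: algebra_simps)
qed

lemma quadratic_diff:
  assumes "quadratic Q" "quadratic Q'"
  shows "quadratic (\<lambda>x. Q x - Q' x)"
  unfolding quadratic_def
proof (intro allI)
  fix x y
  have "Q (x + y) + Q (x - y) - (Q' (x + y) + Q' (x - y)) = 2 *\<^sub>R Q x + 2 *\<^sub>R Q y - (2 *\<^sub>R Q' x + 2 *\<^sub>R Q' y)"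
    using assms unfolding quadratic_def by simp
  then show "Q (x + y) - Q' (x + y) + (Q (x - y) - Q' (x - y)) = 2 *\<^sub>R (Q x - Q' x) + 2 *\<^sub>R (Q y - Q' y)"
    by (simp add: algebra_simps)
qed

lemma quartic_diff:
  assumes "quartic T" "quartic T'"
  shows "quartic (\<lambda>x. T x - T' x)"
  unfolding quartic_def
proof (intro allI)
  fix x y
  have "T (x + 2 *\<^sub>R y) + T (x - 2 *\<^sub>R y) - (T' (x + 2 *\<^sub>R y) + T' (x - 2 *\<^sub>R y))
      = 4 *\<^sub>R (T (x + y) + T (x - y) + 6 *\<^sub>R T y) - 6 *\<^sub>R T x
        - (4 *\<^sub>R (T' (x + y) + T' (x - y) + 6 *\<^sub>R T' y) - 6 *\<^sub>R T' x)"
    using assms unfolding quartic_def by simp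
  then show "T (x + 2 *\<^sub>R y) - T' (x + 2 *\<^sub>R y) + (T (x - 2 *\<^sub>R y) - T' (x - 2 *\<^sub>R y))
      = 4 *\<^sub>R (T (x + y) - T' (x + y) + (T (x - y) - T' (x - y)) + 6 *\<^sub>R (T y - T' y)) - 6 *\<^sub>R (T x - T' x)"
    by (simp add: algebra_simps)
qed

subsection \<open>The combination bounded by Theta\<close>

text \<open>
  The coefficients are the unique solution of the linear system obtained by treating the values of
  an even \<open>G\<close> as independent; the differences \<open>G s - G (- s)\<close> correct for the failure of evenness.
  In absolute value they agree with those in \<open>Theta\<close>, except that \<open>2 * (r\<^sup>2 + 1)\<close> and the last
  two are smaller than their counterparts there.
\<close>
lemma Delta_combination_identity:
  fixes G :: "real \<Rightarrow> 'b::real_vector" and r :: real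
  defines "D \<equiv> \<lambda>a b. G (r * a + b) + G (r * a - b) - r\<^sup>2 *\<^sub>R G (a + b) - r\<^sup>2 *\<^sub>R G (a - b)
     - 2 *\<^sub>R G (r * a) + (2 * r\<^sup>2) *\<^sub>R G a + (2 * (r\<^sup>2 - 1)) *\<^sub>R G b"
  assumes G0: "G 0 = 0"
  shows "(r\<^sup>2 * (r\<^sup>2 - 1)) *\<^sub>R (G 4 - 20 *\<^sub>R G 2 + 64 *\<^sub>R G 1)
    = sum_list
    [(- 1) *\<^sub>R D 1 (r + 2), (- 1) *\<^sub>R D 1 (r - 2), (- 4) *\<^sub>R D 1 (r + 1), (- 4) *\<^sub>R D 1 (r - 1), 10 *\<^sub>R D 1 r,
     1 *\<^sub>R D 2 2, 4 *\<^sub>R D 2 1, (- r\<^sup>2) *\<^sub>R D 1 3, (- (2 * (r\<^sup>2 + 1))) *\<^sub>R D 1 2, (17 * r\<^sup>2 - 8) *\<^sub>R D 1 1,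
     r\<^sup>2 *\<^sub>R (G (r + 1) - G (- (r + 1))), r\<^sup>2 *\<^sub>R (G (r - 3) - G (- (r - 3))),
     (- (10 * r\<^sup>2)) *\<^sub>R (G (r - 1) - G (- (r - 1))), (4 * r\<^sup>2) *\<^sub>R (G r - G (- r)),
     (4 * r\<^sup>2) *\<^sub>R (G (r - 2) - G (- (r - 2))),
     (r ^ 4 - 1) *\<^sub>R (G 2 - G (- 2)), (2 * r ^ 4 + 2 * r\<^sup>2 - 4) *\<^sub>R (G 1 - G (- 1))]"
proof -
  \<comment> \<open>Bringing the sample points to common forms makes equal values of
    \<open>G\<close> syntactically equal, so that they can cancel.\<close>
  have args: "r + (r + 2) = 2 * r + 2" "r - (r + 2) = - 2" "1 + (r + 2) = r + 3" "1 - (r + 2) = - r - 1"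
    "r + (r - 2) = 2 * r - 2" "r - (r - 2) = 2" "1 + (r - 2) = r - 1" "1 - (r - 2) = 3 - r"
    "r + (r + 1) = 2 * r + 1" "r - (r + 1) = - 1" "1 + (r + 1) = r + 2" "1 - (r + 1) = - r"
    "r + (r - 1) = 2 * r - 1" "r - (r - 1) = 1" "1 + (r - 1) = r" "1 - (r - 1) = 2 - r"
    "r + r = 2 * r" "r - r = 0" "1 + r = r + 1" "r * 1 = r" "r * 2 = 2 * r"
    "- (r + 1) = - r - 1" "- (r - 3) = 3 - r" "- (r - 1) = 1 - r" "- (r - 2) = 2 - r"
    "(1::real) + 3 = 4" "(1::real) - 3 = - 2" "(1::real) + 2 = 3" "(1::real) - 2 = - 1"
    "(1::real) + 1 = 2" "(1::real) - 1 = 0" "(2::real) + 2 = 4" "(2::real) - 2 = 0"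
    "(2::real) + 1 = 3" "(2::real) - 1 = 1"
    by simp_all
  show ?thesis
    unfolding D_def args G0 sum_list.Cons sum_list.Nil
  proof (rule eq_if_linear_functionals_eq, goal_cases)
    case (1 L)
    show ?case
      by (simp only: linear_add[OF 1] linear_diff[OF 1] linear_neg[OF 1] linear_scale[OF 1] linear_0[OF 1]
          real_scaleR_def) (simp add: algebra_simps)
  qed
qed

subsection \<open>p-Banach spaces\<close>

locale p_Banach_space =
  fixes N :: "'b::real_vector \<Rightarrow> real" and p :: real
  assumes p_Banach: "p_Banach p N" and p_pos: "0 < p"
begin

text \<open>Subadditivity turns \<open>P (u - v)\<close> into a translation-invariant metric, so
  sums of any length are estimated without accumulating powers of the modulus of concavity.\<close>

definition P :: "'b \<Rightarrow> real" where "P v = N v powr p"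

lemma N_nonneg [simp]: "0 \<le> N v"
  and N_eq_0_iff: "N v = 0 \<longleftrightarrow> v = 0"
  and N_scaleR: "N (c *\<^sub>R v) = \<bar>c\<bar> * N v"
  using p_Banach by (simp_all add: p_Banach_def quasi_Banach_def quasi_norm_def)

lemma N_0 [simp]: "N 0 = 0"
  by (simp add: N_eq_0_iff)

lemma P_nonneg [simp]: "0 \<le> P v"
  by (simp add: P_def)

lemma P_eq_0_iff: "P v = 0 \<longleftrightarrow> v = 0"
  by (simp add: P_def N_eq_0_iff)

lemma P_0 [simp]: "P 0 = 0"
  by (simp add: P_eq_0_iff)

lemma P_scaleR: "P (c *\<^sub>R v) = \<bar>c\<bar> powr p * P v"
  by (simp add: P_def N_scaleR powr_mult)

lemma P_add: "P (u + v) \<le> P u + P v"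
  using p_Banach by (simp add: p_Banach_def P_def)

lemma P_minus: "P (- v) = P v"
  using P_scaleR[of "-1" v] by simp

lemma P_diff: "P (u - v) \<le> P u + P v"
  using P_add[of u "- v"] by (simp add: P_minus)

lemma P_minus_commute: "P (u - v) = P (v - u)"
  using P_minus[of "u - v"] by simp

lemma P_sum_list: "P (sum_list vs) \<le> sum_list (map P vs)"
proof (induction vs)
  case (Cons v vs)
  then show ?case using P_add[of v "sum_list vs"] by simp
qed simp

lemma P_scaleR_le:
  assumes "N v \<le> b" "\<bar>c\<bar> \<le> d"
  shows "P (c *\<^sub>R v) \<le> d powr p * b powr p"
  unfolding P_scaleR unfolding P_def
  using assms p_pos by (intro mult_mono powr_mono2) auto

text \<open>\<open>LEAST\<close> on the reals is informative only if the minimum is attained. It is,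
  because the concavity inequality is a closed condition on the constant and so passes to the
  infimum.\<close>

lemma N_concavity: "N (u + v) \<le> modulus_of_concavity N * (N u + N v)"
  and modulus_of_concavity_ge_1: "1 \<le> modulus_of_concavity N"
proof -
  define S where "S = {K. concavity_bound N K}"
  have S_ne: "S \<noteq> {}"
    using p_Banach by (auto simp: p_Banach_def quasi_Banach_def quasi_norm_def S_def)
  have S_bdd: "bdd_below S"
    by (auto simp: S_def concavity_bound_def intro!: bdd_belowI[of _ 1])
  have "N (u + v) \<le> Inf S * (N u + N v)" for u v
  proof (cases "N u + N v = 0")
    case True
    moreover from this have "N u = 0" "N v = 0"
      by (metis N_nonneg add_nonneg_eq_0_iff)+
    ultimately show ?thesis by (simp add: N_eq_0_iff)
  next
    case False
    then have pos: "N u + N v > 0" by (metis N_nonneg add_nonneg_nonneg less_eq_real_def)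
    have "N (u + v) / (N u + N v) \<le> Inf S"
      using pos by (intro cInf_greatest[OF S_ne]) (auto simp: S_def concavity_bound_def divide_le_eq)
    then show ?thesis using pos by (simp add: divide_le_eq)
  qed
  moreover have "1 \<le> Inf S"
    by (intro cInf_greatest[OF S_ne]) (auto simp: S_def concavity_bound_def)
  ultimately have "concavity_bound N (Inf S)" by (auto simp: concavity_bound_def)
  moreover have "Inf S \<le> K" if "concavity_bound N K" for K
    using that by (intro cInf_lower S_bdd) (simp add: S_def)
  ultimately have "modulus_of_concavity N = Inf S"
    unfolding modulus_of_concavity_def by (intro Least_equality)
  with \<open>concavity_bound N (Inf S)\<close> show "N (u + v) \<le> modulus_of_concavity N * (N u + N v)"
    and "1 \<le> modulus_of_concavity N"
    by (auto simp: concavity_bound_def)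
qed

text \<open>As \<open>p > 0\<close>, this is convergence with respect to \<open>N\<close>; stating
  it through \<open>P\<close> gives the limit laws directly from the triangle inequality.\<close>

definition tends :: "(nat \<Rightarrow> 'b) \<Rightarrow> 'b \<Rightarrow> bool" where
  "tends s l \<longleftrightarrow> (\<lambda>k. P (s k - l)) \<longlonglongrightarrow> 0"

lemma tends_unique:
  assumes "tends s l" "tends s l'"
  shows "l = l'"
proof -
  have "(\<lambda>k. P (s k - l) + P (s k - l')) \<longlonglongrightarrow> 0"
    using assms by (auto simp: tends_def intro: tendsto_add_zero)
  moreover have "P (l - l') \<le> P (s k - l) + P (s k - l')" for k
    using P_diff[of "s k - l'" "s k - l"] by simp
  ultimately have "P (l - l') \<le> 0" by (meson LIMSEQ_le_const)
  then have "P (l - l') = 0" by (simp add: order_antisym)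
  then show ?thesis by (simp add: P_eq_0_iff)
qed

lemma tends_add:
  assumes "tends s l" "tends t m"
  shows "tends (\<lambda>k. s k + t k) (l + m)"
  unfolding tends_def
proof (rule tendsto_sandwich[OF _ _ tendsto_const])
  show "(\<lambda>k. P (s k - l) + P (t k - m)) \<longlonglongrightarrow> 0"
    using assms by (auto simp: tends_def intro: tendsto_add_zero)
  show "\<forall>\<^sub>F k in sequentially. P (s k + t k - (l + m)) \<le> P (s k - l) + P (t k - m)"
    by (intro always_eventually allI) (metis P_add add_diff_add)
qed simp

lemma tends_scaleR:
  assumes "tends s l"
  shows "tends (\<lambda>k. c *\<^sub>R s k) (c *\<^sub>R l)"
  using tendsto_mult_right_zero[OF assms[unfolded tends_def], of "\<bar>c\<bar> powr p"]
  by (simp add: tends_def P_scaleR flip: scaleR_diff_right)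

lemma tends_diff:
  assumes "tends s l" "tends t m"
  shows "tends (\<lambda>k. s k - t k) (l - m)"
  using tends_add[OF assms(1) tends_scaleR[OF assms(2), of "-1"]] by simp

lemma tends_0I:
  assumes "\<And>k. N (s k) \<le> b k" "b \<longlonglongrightarrow> 0"
  shows "tends s 0"
  unfolding tends_def
proof (rule tendsto_sandwich[OF _ _ tendsto_const])
  have b: "b k \<ge> 0" for k by (rule order_trans[OF N_nonneg assms(1)])
  show "(\<lambda>k. b k powr p) \<longlonglongrightarrow> 0"
    using tendsto_zero_powrI[OF assms(2) tendsto_const[of p]] b p_pos by simp
  show "\<forall>\<^sub>F k in sequentially. P (s k - 0) \<le> b k powr p"
    using assms(1) p_pos by (intro always_eventually allI) (simp add: P_def powr_mono2)
qed simp

text \<open>Telescoping with the subadditive \<open>P\<close> bounds differences by tails of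
  \<open>a\<close>, so the sequence is Cauchy for \<open>N\<close> and completeness gives the limit.
  The same bound from index 0, passed to the limit, estimates the distance to it.\<close>

lemma summable_increments_tends:
  assumes inc: "\<And>k. P (s (Suc k) - s k) \<le> a k" and a: "summable a"
  obtains l where "tends s l" and "P (s 0 - l) \<le> suminf a"
proof -
  have a_nonneg: "a k \<ge> 0" for k by (rule order_trans[OF P_nonneg inc])
  have tele: "P (s (i + d) - s i) \<le> sum a {i..<i + d}" for i d
  proof (induction d)
    case (Suc d)
    have "P (s (i + Suc d) - s i) \<le> P (s (Suc (i + d)) - s (i + d)) + P (s (i + d) - s i)"
      using P_add[of "s (Suc (i + d)) - s (i + d)" "s (i + d) - s i"] by simp
    with Suc inc[of "i + d"] show ?case by simp
  qed simp
  have tele': "P (s i - s j) \<le> (\<Sum>k. a k) - sum a {..<m}" if "m \<le> i" "m \<le> j" for i j m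
  proof -
    have *: "P (s j - s i) \<le> (\<Sum>k. a k) - sum a {..<m}" if "m \<le> i" "i \<le> j" for i j
    proof -
      have "P (s j - s i) \<le> sum a {i..<j}" using tele[of i "j - i"] that by simp
      also have "\<dots> \<le> sum a {m..<j}" using that by (intro sum_mono2) (auto simp: a_nonneg)
      also have "\<dots> = sum a {..<j} - sum a {..<m}"
        using that sum_diff_nat_ivl[of 0 m j a] by (simp add: lessThan_atLeast0)
      also have "\<dots> \<le> (\<Sum>k. a k) - sum a {..<m}"
        using sum_le_suminf[OF a, of "{..<j}"] a_nonneg by simp
      finally show ?thesis .
    qed
    show ?thesis using *[of i j] *[of j i] that P_minus_commute[of "s i" "s j"] by (cases "i \<le> j") auto
  qed
  have tail: "(\<lambda>m. (\<Sum>k. a k) - sum a {..<m}) \<longlonglongrightarrow> 0"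
    using tendsto_diff[OF tendsto_const summable_LIMSEQ[OF a], of "suminf a"] by simp
  have "\<exists>m. \<forall>i\<ge>m. \<forall>j\<ge>m. N (s i - s j) < e" if "e > 0" for e
  proof -
    have "e powr p > 0" using that by simp
    then have "\<forall>\<^sub>F m in sequentially. (\<Sum>k. a k) - sum a {..<m} < e powr p"
      using tail by (rule order_tendstoD(2)[rotated])
    then obtain m where "(\<Sum>k. a k) - sum a {..<m} < e powr p" by (auto simp: eventually_sequentially)
    then have "N (s i - s j) powr p < e powr p" if "i \<ge> m" "j \<ge> m" for i j
      using tele'[OF that] by (simp add: P_def)
    then have "N (s i - s j) < e" if "i \<ge> m" "j \<ge> m" for i j
      using that p_pos \<open>e > 0\<close> powr_mono2[of p e "N (s i - s j)"] by (meson less_imp_le linorder_not_le)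
    then show ?thesis by blast
  qed
  then obtain l where l: "(\<lambda>k. N (s k - l)) \<longlonglongrightarrow> 0"
    using p_Banach unfolding p_Banach_def quasi_Banach_def quasi_complete_def by meson
  have tends: "tends s l"
    using tendsto_zero_powrI[OF l tendsto_const[of p]] p_pos by (simp add: tends_def P_def)
  moreover have "P (s 0 - l) \<le> suminf a"
  proof (rule LIMSEQ_le_const)
    show "(\<lambda>k. P (s k - l) + suminf a) \<longlonglongrightarrow> suminf a"
      using tendsto_add[OF tends[unfolded tends_def] tendsto_const] by simp
    have "P (s 0 - l) \<le> P (s k - l) + suminf a" for k
      using tele'[of 0 0 k] P_add[of "s 0 - s k" "s k - l"] by simp
    then show "\<exists>N. \<forall>k\<ge>N. P (s 0 - l) \<le> P (s k - l) + suminf a" by blast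
  qed
  ultimately show ?thesis by (rule that)
qed

end

subsection \<open>Stability\<close>

text \<open>This is \<open>g (2x) - 4 g x\<close> for \<open>g x = F (2x) - 16 F x\<close> and also
  \<open>h (2x) - 16 h x\<close> for \<open>h x = F (2x) - 4 F x\<close>, so one bound controls both
  limits.\<close>

definition dyadic_defect :: "('a::real_vector \<Rightarrow> 'b::real_vector) \<Rightarrow> 'a \<Rightarrow> 'b" where
  "dyadic_defect F x = F (4 *\<^sub>R x) - 20 *\<^sub>R F (2 *\<^sub>R x) + 64 *\<^sub>R F x"

lemma Delta_on_line:
  "Delta n F (a *\<^sub>R x) (b *\<^sub>R x) =
     F ((real_of_int n * a + b) *\<^sub>R x) + F ((real_of_int n * a - b) *\<^sub>R x)
     - (real_of_int n)\<^sup>2 *\<^sub>R F ((a + b) *\<^sub>R x) - (real_of_int n)\<^sup>2 *\<^sub>R F ((a - b) *\<^sub>R x)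
     - 2 *\<^sub>R F ((real_of_int n * a) *\<^sub>R x) + (2 * (real_of_int n)\<^sup>2) *\<^sub>R F (a *\<^sub>R x)
     + (2 * ((real_of_int n)\<^sup>2 - 1)) *\<^sub>R F (b *\<^sub>R x)"
  by (simp add: Delta_def Let_def scaleR_add_left scaleR_diff_left)

text \<open>The identity for functions of a real variable is applied to \<open>F\<close> on the line
  through \<open>x\<close>. The odd parts of \<open>F\<close> are replaced by values of
  \<open>Delta\<close> at 0, which brings in the denominators \<open>r^2 - 1\<close>.\<close>

lemma dyadic_defect_expansion:
  fixes F :: "'a::real_vector \<Rightarrow> 'b::real_vector" and x :: 'a
  assumes n: "n \<noteq> 0" "n \<noteq> 1" "n \<noteq> -1" and F0: "F 0 = 0"
  defines "r \<equiv> real_of_int n"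
  defines "D \<equiv> \<lambda>a b. Delta n F (a *\<^sub>R x) (b *\<^sub>R x)"
  shows "(r\<^sup>2 * (r\<^sup>2 - 1)) *\<^sub>R dyadic_defect F x = sum_list
    [(- 1) *\<^sub>R D 1 (r + 2), (- 1) *\<^sub>R D 1 (r - 2), (- 4) *\<^sub>R D 1 (r + 1), (- 4) *\<^sub>R D 1 (r - 1), 10 *\<^sub>R D 1 r,
     1 *\<^sub>R D 2 2, 4 *\<^sub>R D 2 1, (- r\<^sup>2) *\<^sub>R D 1 3, (- (2 * (r\<^sup>2 + 1))) *\<^sub>R D 1 2, (17 * r\<^sup>2 - 8) *\<^sub>R D 1 1,
     (r\<^sup>2 / (r\<^sup>2 - 1)) *\<^sub>R D 0 (r + 1), (r\<^sup>2 / (r\<^sup>2 - 1)) *\<^sub>R D 0 (r - 3),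
     (- (10 * r\<^sup>2) / (r\<^sup>2 - 1)) *\<^sub>R D 0 (r - 1), (4 * r\<^sup>2 / (r\<^sup>2 - 1)) *\<^sub>R D 0 r,
     (4 * r\<^sup>2 / (r\<^sup>2 - 1)) *\<^sub>R D 0 (r - 2),
     ((r ^ 4 - 1) / (r\<^sup>2 - 1)) *\<^sub>R D 0 2, ((2 * r ^ 4 + 2 * r\<^sup>2 - 4) / (r\<^sup>2 - 1)) *\<^sub>R D 0 1]"
proof -
  define G where "G s = F (s *\<^sub>R x)" for s
  have r2: "r\<^sup>2 - 1 \<noteq> 0" using int_square_gt_1[OF n] by (simp add: r_def)
  have odd: "(c / (r\<^sup>2 - 1)) *\<^sub>R D 0 b = c *\<^sub>R (G b - G (- b))" for b c
    using r2 Delta_0_left[of F n "b *\<^sub>R x", OF F0] by (simp add: D_def G_def r_def)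
  have D: "D a b = G (r * a + b) + G (r * a - b) - r\<^sup>2 *\<^sub>R G (a + b) - r\<^sup>2 *\<^sub>R G (a - b)
     - 2 *\<^sub>R G (r * a) + (2 * r\<^sup>2) *\<^sub>R G a + (2 * (r\<^sup>2 - 1)) *\<^sub>R G b" for a b
    unfolding D_def G_def r_def by (rule Delta_on_line)
  have "dyadic_defect F x = G 4 - 20 *\<^sub>R G 2 + 64 *\<^sub>R G 1" by (simp add: dyadic_defect_def G_def)
  then show ?thesis
    using Delta_combination_identity[of G r, folded D] F0 unfolding odd by (simp only: G_def scaleR_zero_left)
qed

lemma (in p_Banach_space) dyadic_defect_le_Theta:
  assumes n: "n \<noteq> 0" "n \<noteq> 1" "n \<noteq> -1" and F0: "F 0 = 0"
    and F: "\<And>x y. N (Delta n F x y) \<le> \<phi> x y"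
  shows "P (dyadic_defect F x) \<le> Theta n p \<phi> x"
proof -
  define r where "r = real_of_int n"
  define k where "k = r\<^sup>2 - 1"
  define \<Phi> where "\<Phi> u v = \<phi> u v powr p" for u v
  define D where "D a b = Delta n F (a *\<^sub>R x) (b *\<^sub>R x)" for a b
  have k: "k > 0" using int_square_gt_1[OF n] by (simp add: r_def k_def)
  have r2: "r\<^sup>2 \<ge> 1" using k by (simp add: k_def)
  have "r \<noteq> 0" using n by (simp add: r_def)
  have powr_2_mult: "(2 * (3 * r\<^sup>2 - 1)) powr p = 2 powr p * (3 * r\<^sup>2 - 1) powr p"
    by (rule powr_mult)
  \<comment> \<open>Used to compare the last coefficient \<open>2r^4 + 2r^2 - 4\<close> with
    \<open>2(3r^4 - r^2 + 2)\<close>.\<close>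
  have r4: "r ^ 4 \<ge> r\<^sup>2" using mult_left_mono[OF r2, of "r\<^sup>2"] by (simp add: power4_eq_xxxx power2_eq_square mult.assoc)
  have P_le: "P (c *\<^sub>R D a b) \<le> d powr p * \<Phi> (a *\<^sub>R x) (b *\<^sub>R x)" if "\<bar>c\<bar> \<le> d" for a b c d
    unfolding D_def \<Phi>_def by (rule P_scaleR_le[OF F that])
  have P_le_k: "P ((c / k) *\<^sub>R D a b) \<le> d powr p / k powr p * \<Phi> (a *\<^sub>R x) (b *\<^sub>R x)"
    if "\<bar>c\<bar> \<le> d" for a b c d
    using P_le[of "c / k" "d / k" a b] that k by (simp add: powr_divide divide_right_mono)
  have "P ((r\<^sup>2 * k) *\<^sub>R dyadic_defect F x) \<le> sum_list (map P
    [(- 1) *\<^sub>R D 1 (r + 2), (- 1) *\<^sub>R D 1 (r - 2), (- 4) *\<^sub>R D 1 (r + 1), (- 4) *\<^sub>R D 1 (r - 1), 10 *\<^sub>R D 1 r,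
     1 *\<^sub>R D 2 2, 4 *\<^sub>R D 2 1, (- r\<^sup>2) *\<^sub>R D 1 3, (- (2 * (r\<^sup>2 + 1))) *\<^sub>R D 1 2, (17 * r\<^sup>2 - 8) *\<^sub>R D 1 1,
     (r\<^sup>2 / k) *\<^sub>R D 0 (r + 1), (r\<^sup>2 / k) *\<^sub>R D 0 (r - 3),
     (- (10 * r\<^sup>2) / k) *\<^sub>R D 0 (r - 1), (4 * r\<^sup>2 / k) *\<^sub>R D 0 r,
     (4 * r\<^sup>2 / k) *\<^sub>R D 0 (r - 2),
     ((r ^ 4 - 1) / k) *\<^sub>R D 0 2, ((2 * r ^ 4 + 2 * r\<^sup>2 - 4) / k) *\<^sub>R D 0 1])"
    unfolding r_def k_def D_def dyadic_defect_expansion[of n F x, OF n F0] by (rule P_sum_list)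
  also have "\<dots> \<le> sum_list
    [1 powr p * \<Phi> (1 *\<^sub>R x) ((r + 2) *\<^sub>R x), 1 powr p * \<Phi> (1 *\<^sub>R x) ((r - 2) *\<^sub>R x),
     4 powr p * \<Phi> (1 *\<^sub>R x) ((r + 1) *\<^sub>R x), 4 powr p * \<Phi> (1 *\<^sub>R x) ((r - 1) *\<^sub>R x),
     10 powr p * \<Phi> (1 *\<^sub>R x) (r *\<^sub>R x), 1 powr p * \<Phi> (2 *\<^sub>R x) (2 *\<^sub>R x), 4 powr p * \<Phi> (2 *\<^sub>R x) (1 *\<^sub>R x),
     (r\<^sup>2) powr p * \<Phi> (1 *\<^sub>R x) (3 *\<^sub>R x), (2 * (3 * r\<^sup>2 - 1)) powr p * \<Phi> (1 *\<^sub>R x) (2 *\<^sub>R x),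
     (17 * r\<^sup>2 - 8) powr p * \<Phi> (1 *\<^sub>R x) (1 *\<^sub>R x),
     (r\<^sup>2) powr p / k powr p * \<Phi> (0 *\<^sub>R x) ((r + 1) *\<^sub>R x), (r\<^sup>2) powr p / k powr p * \<Phi> (0 *\<^sub>R x) ((r - 3) *\<^sub>R x),
     (10 * r\<^sup>2) powr p / k powr p * \<Phi> (0 *\<^sub>R x) ((r - 1) *\<^sub>R x), (4 * r\<^sup>2) powr p / k powr p * \<Phi> (0 *\<^sub>R x) (r *\<^sub>R x),
     (4 * r\<^sup>2) powr p / k powr p * \<Phi> (0 *\<^sub>R x) ((r - 2) *\<^sub>R x),
     (r ^ 4 + 1) powr p / k powr p * \<Phi> (0 *\<^sub>R x) (2 *\<^sub>R x),
     (2 * (3 * r ^ 4 - r\<^sup>2 + 2)) powr p / k powr p * \<Phi> (0 *\<^sub>R x) (1 *\<^sub>R x)]"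
    unfolding list.map sum_list.Cons sum_list.Nil
    by (intro add_mono P_le P_le_k order_refl) (use r2 r4 in auto)
  also have "\<dots> = (r\<^sup>2 * k) powr p * Theta n p \<phi> x"
    unfolding powr_2_mult using k r2 \<open>r \<noteq> 0\<close>
    by (simp add: Theta_def Let_def powr_mult \<Phi>_def flip: r_def k_def)
      (simp add: algebra_simps add_divide_distrib)
  finally have "(r\<^sup>2 * k) powr p * P (dyadic_defect F x) \<le> (r\<^sup>2 * k) powr p * Theta n p \<phi> x"
    using k by (simp add: P_scaleR)
  moreover have "(r\<^sup>2 * k) powr p > 0" using k \<open>r \<noteq> 0\<close> by simp
  ultimately show ?thesis by (simp only: mult_le_cancel_left_pos)
qed

section \<open>The control series and their behaviour under dyadic rescaling\<close>

lemma Theta_nonneg: "0 \<le> Theta n p \<phi> x"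
  unfolding Theta_def Let_def
  by (intro mult_nonneg_nonneg add_nonneg_nonneg divide_nonneg_nonneg) simp_all

lemma psi_q_term_nonneg: "0 \<le> psi_q_term n p \<phi> x i"
  and psi_t_term_nonneg: "0 \<le> psi_t_term n p \<phi> x i"
  by (simp_all add: psi_q_term_def psi_t_term_def Theta_nonneg)

lemma psi_q_nonneg: "summable (psi_q_term n p \<phi> x) \<Longrightarrow> 0 \<le> psi_q n p \<phi> x"
  unfolding psi_q_def by (intro suminf_nonneg psi_q_term_nonneg)

lemma psi_t_nonneg: "summable (psi_t_term n p \<phi> x) \<Longrightarrow> 0 \<le> psi_t n p \<phi> x"
  unfolding psi_t_def by (intro suminf_nonneg psi_t_term_nonneg)

text \<open>Doubling the argument shifts the series by one place: a factor \<open>4 powr p\<close>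
  comes out and a new head term appears.\<close>

lemma psi_q_double:
  assumes "\<And>x. summable (psi_q_term n p \<phi> x)"
  shows "psi_q n p \<phi> (2 *\<^sub>R x) = 4 powr p * (Theta n p \<phi> x + psi_q n p \<phi> x)"
proof -
  have "psi_q_term n p \<phi> (2 *\<^sub>R x) (Suc i) = 4 powr p * psi_q_term n p \<phi> x i" for i
  proof -
    have "4 powr (p * real (Suc (Suc i))) = 4 powr p * 4 powr (p * real (Suc i))"
      by (subst of_nat_Suc) (simp only: distrib_left powr_add mult_1_right)
    moreover have "(2 *\<^sub>R x) /\<^sub>R 2 ^ Suc (Suc i) = x /\<^sub>R 2 ^ Suc i" by simp
    ultimately show ?thesis by (simp only: psi_q_term_def mult.assoc)
  qed
  moreover have "psi_q_term n p \<phi> (2 *\<^sub>R x) 0 = 4 powr p * Theta n p \<phi> x"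
    by (simp add: psi_q_term_def)
  ultimately show ?thesis
    unfolding psi_q_def using suminf_split_head[OF assms, of "2 *\<^sub>R x"] suminf_mult[OF assms, of "4 powr p" x]
    by (simp add: distrib_left)
qed

lemma psi_t_split:
  assumes "\<And>x. summable (psi_t_term n p \<phi> x)"
  shows "psi_t n p \<phi> x = Theta n p \<phi> x + psi_t n p \<phi> (2 *\<^sub>R x) / 16 powr p"
proof -
  have "psi_t_term n p \<phi> x (Suc i) = 1 / 16 powr p * psi_t_term n p \<phi> (2 *\<^sub>R x) i" for i
    by (simp add: psi_t_term_def distrib_left powr_add mult.commute)
  moreover have "psi_t_term n p \<phi> x 0 = Theta n p \<phi> x"
    by (simp add: psi_t_term_def)
  ultimately show ?thesis
    unfolding psi_t_def using suminf_split_head[OF assms, of x] suminf_mult[OF assms, of "1 / 16 powr p" "2 *\<^sub>R x"]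
    by simp
qed

text \<open>The recursion and the initial value identify \<open>u m\<close> as the remainder of the
  series of \<open>a\<close> from index \<open>m\<close> on.\<close>

lemma telescoping_tendsto_0:
  fixes u a :: "nat \<Rightarrow> real"
  assumes "\<And>m. u m = a m + u (Suc m)" "summable a" "u 0 = suminf a"
  shows "u \<longlonglongrightarrow> 0"
proof -
  have u: "u m = suminf a - sum a {..<m}" for m
  proof (induction m)
    case (Suc m)
    then show ?case using assms(1)[of m] by simp
  qed (simp add: assms(3))
  have "(\<lambda>m. suminf a - sum a {..<m}) \<longlonglongrightarrow> suminf a - suminf a"
    by (intro tendsto_diff tendsto_const summable_LIMSEQ assms(2))
  then show ?thesis by (simp flip: u)
qed

text \<open>Summing the recursion bounds \<open>(1 - r)\<close> times each partial sum of
  \<open>v\<close> by \<open>v 0 + suminf a\<close>. Hence \<open>v\<close> is summable and its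
  terms vanish in the limit.\<close>

lemma contraction_tendsto_0:
  fixes v a :: "nat \<Rightarrow> real"
  assumes step: "\<And>m. v (Suc m) = a m + r * v m" and a: "summable a" "\<And>m. 0 \<le> a m"
    and v: "\<And>m. 0 \<le> v m" and r: "r < 1"
  shows "v \<longlonglongrightarrow> 0"
proof (rule summable_LIMSEQ_zero, rule summableI_nonneg_bounded)
  show "0 \<le> v m" for m by (rule v)
  fix m
  have "sum v {..<m} \<le> sum v {..<Suc m}" by (simp add: v)
  also have "\<dots> = v 0 + sum a {..<m} + r * sum v {..<m}"
    by (subst sum.lessThan_Suc_shift) (simp add: step sum.distrib sum_distrib_left)
  also have "sum a {..<m} \<le> suminf a" by (intro sum_le_suminf a) auto
  finally have "(1 - r) * sum v {..<m} \<le> v 0 + suminf a" by (simp add: algebra_simps)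
  then show "sum v {..<m} \<le> (v 0 + suminf a) / (1 - r)" using r by (simp add: field_simps)
qed

lemma powr_inverse_tendsto_0:
  fixes c p :: real and g :: "nat \<Rightarrow> real"
  assumes "(\<lambda>m. c powr (p * real m) * g m) \<longlonglongrightarrow> 0" "\<And>m. 0 \<le> g m" "0 < p" "0 < c"
  shows "(\<lambda>m. c ^ m * g m powr (1 / p)) \<longlonglongrightarrow> 0"
proof -
  have "(\<lambda>m. (c powr (p * real m) * g m) powr (1 / p)) \<longlonglongrightarrow> 0"
    using assms by (intro tendsto_zero_powrI[OF assms(1) tendsto_const]) auto
  moreover have "(c powr (p * real m) * g m) powr (1 / p) = c ^ m * g m powr (1 / p)" for m
    using assms by (simp add: powr_mult powr_powr powr_realpow)
  ultimately show ?thesis by simp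
qed

text \<open>When the rescaling matches the series, the rescaled \<open>p\<close>-th powers are its
  remainders. In the two mixed cases they obey a recursion with contraction factor
  \<open>1 / 4 powr p\<close>, driven by the terms of the other series up to a constant.\<close>

lemma psi_rescaled_tendsto_0:
  fixes x :: "'a::real_vector"
  assumes p: "0 < p"
    and q: "\<And>x. summable (psi_q_term n p \<phi> x)" and t: "\<And>x. summable (psi_t_term n p \<phi> x)"
  shows "(\<lambda>m. 4 ^ m * psi_q n p \<phi> (x /\<^sub>R 2 ^ m) powr (1 / p)) \<longlonglongrightarrow> 0"
    and "(\<lambda>m. 4 ^ m * psi_t n p \<phi> (x /\<^sub>R 2 ^ m) powr (1 / p)) \<longlonglongrightarrow> 0"
    and "(\<lambda>m. (1 / 16) ^ m * psi_q n p \<phi> (2 ^ m *\<^sub>R x) powr (1 / p)) \<longlonglongrightarrow> 0"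
    and "(\<lambda>m. (1 / 16) ^ m * psi_t n p \<phi> (2 ^ m *\<^sub>R x) powr (1 / p)) \<longlonglongrightarrow> 0"
proof -
  have half: "x /\<^sub>R 2 ^ m = 2 *\<^sub>R (x /\<^sub>R 2 ^ Suc m)" for m by simp
  have double: "2 ^ Suc m *\<^sub>R x = 2 *\<^sub>R (2 ^ m *\<^sub>R x)" for m by simp
  have powr_4_Suc: "4 powr (p * real (Suc m)) = 4 powr p * 4 powr (p * real m)" for m
    by (simp add: distrib_left powr_add)
  have powr_16_Suc: "(1 / 16) powr (p * real (Suc m)) = (1 / 16) powr (p * real m) / 16 powr p" for m
    by (simp add: distrib_left powr_add powr_divide)
  have powr_16: "(16::real) powr p = 4 powr p * 4 powr p"
    by (simp flip: powr_mult)
  have powr_4: "(4::real) powr p > 1" using p by (simp add: gr_one_powr)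
  have t_term: "psi_t_term n p \<phi> x m = (1 / 16) powr (p * real m) * Theta n p \<phi> (2 ^ m *\<^sub>R x)" for m
    by (simp add: psi_t_term_def powr_divide)
  note nonneg = psi_q_nonneg[OF q] psi_t_nonneg[OF t]
  show "(\<lambda>m. 4 ^ m * psi_q n p \<phi> (x /\<^sub>R 2 ^ m) powr (1 / p)) \<longlonglongrightarrow> 0"
  proof (intro powr_inverse_tendsto_0 telescoping_tendsto_0)
    show "4 powr (p * real m) * psi_q n p \<phi> (x /\<^sub>R 2 ^ m) =
        psi_q_term n p \<phi> x m + 4 powr (p * real (Suc m)) * psi_q n p \<phi> (x /\<^sub>R 2 ^ Suc m)" for m
      unfolding half[of m] psi_q_double[OF q] psi_q_term_def powr_4_Suc by (simp add: algebra_simps)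
  qed (use p q nonneg in \<open>simp_all add: psi_q_def\<close>)
  show "(\<lambda>m. 4 ^ m * psi_t n p \<phi> (x /\<^sub>R 2 ^ m) powr (1 / p)) \<longlonglongrightarrow> 0"
  proof (intro powr_inverse_tendsto_0 contraction_tendsto_0)
    show "4 powr (p * real (Suc m)) * psi_t n p \<phi> (x /\<^sub>R 2 ^ Suc m) =
        psi_q_term n p \<phi> x m + 1 / 4 powr p * (4 powr (p * real m) * psi_t n p \<phi> (x /\<^sub>R 2 ^ m))" for m
      unfolding psi_t_split[OF t, of "x /\<^sub>R 2 ^ Suc m", folded half] psi_q_term_def powr_4_Suc powr_16
      by (simp add: field_simps)
  qed (use p q nonneg powr_4 in \<open>simp_all add: psi_q_term_nonneg\<close>)
  show "(\<lambda>m. (1 / 16) ^ m * psi_t n p \<phi> (2 ^ m *\<^sub>R x) powr (1 / p)) \<longlonglongrightarrow> 0"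
  proof (intro powr_inverse_tendsto_0 telescoping_tendsto_0)
    show "(1 / 16) powr (p * real m) * psi_t n p \<phi> (2 ^ m *\<^sub>R x) =
        psi_t_term n p \<phi> x m + (1 / 16) powr (p * real (Suc m)) * psi_t n p \<phi> (2 ^ Suc m *\<^sub>R x)" for m
      unfolding psi_t_split[OF t, of "2 ^ m *\<^sub>R x"] double t_term powr_16_Suc by (simp add: algebra_simps)
  qed (use p t nonneg in \<open>simp_all add: psi_t_def\<close>)
  show "(\<lambda>m. (1 / 16) ^ m * psi_q n p \<phi> (2 ^ m *\<^sub>R x) powr (1 / p)) \<longlonglongrightarrow> 0"
  proof (intro powr_inverse_tendsto_0 contraction_tendsto_0)
    show "(1 / 16) powr (p * real (Suc m)) * psi_q n p \<phi> (2 ^ Suc m *\<^sub>R x) =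
        1 / 4 powr p * psi_t_term n p \<phi> x m
        + 1 / 4 powr p * ((1 / 16) powr (p * real m) * psi_q n p \<phi> (2 ^ m *\<^sub>R x))" for m
      unfolding double psi_q_double[OF q] t_term powr_16_Suc powr_16 by (simp add: field_simps)
  qed (use p t nonneg powr_4 in \<open>simp_all add: summable_divide psi_t_term_nonneg\<close>)
qed

section \<open>Limits of the rescaled functions and separation of the two parts\<close>

context p_Banach_space
begin

lemma tends_Suc: "tends s l \<Longrightarrow> tends (\<lambda>k. s (Suc k)) l"
  unfolding tends_def by (rule LIMSEQ_Suc)

text \<open>\<open>Delta\<close> is linear in the function and commutes with scaling the arguments,
  so on the approximants it is a combination of two terms that \<open>lim\<close> drives to 0. Being
  a finite combination of values, it passes to the limit. The scalings are parameters so that both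
  the shrinking and the growing sequence fit.\<close>

lemma Delta_limit_zero:
  fixes F L :: "'a::real_vector \<Rightarrow> 'b" and a b :: "nat \<Rightarrow> real"
  assumes F: "\<And>x y. N (Delta n F x y) \<le> \<phi> x y"
    and b: "\<And>m. 0 \<le> b m"
    and lim: "\<And>x y. (\<lambda>m. b m * \<phi> (a m *\<^sub>R x) (a m *\<^sub>R y)) \<longlonglongrightarrow> 0"
    and L: "\<And>x. tends (\<lambda>m. b m *\<^sub>R (F (a m *\<^sub>R 2 *\<^sub>R x) - e *\<^sub>R F (a m *\<^sub>R x))) (L x)"
  shows "Delta n L x y = 0"
proof (rule tends_unique)
  define S where "S m z = b m *\<^sub>R (F (a m *\<^sub>R 2 *\<^sub>R z) - e *\<^sub>R F (a m *\<^sub>R z))" for m z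
  have S: "tends (\<lambda>m. S m z) (L z)" for z unfolding S_def by (rule L)
  show "tends (\<lambda>m. Delta n (S m) x y) (Delta n L x y)"
    unfolding Delta_def Let_def by (intro tends_add tends_diff tends_scaleR S)
  have Delta_0: "tends (\<lambda>m. b m *\<^sub>R Delta n F (a m *\<^sub>R x) (a m *\<^sub>R y)) 0" for x y
    using F b by (intro tends_0I[OF _ lim[of x y]]) (simp add: N_scaleR mult_left_mono)
  have "tends (\<lambda>m. b m *\<^sub>R Delta n F (a m *\<^sub>R 2 *\<^sub>R x) (a m *\<^sub>R 2 *\<^sub>R y)
      - e *\<^sub>R (b m *\<^sub>R Delta n F (a m *\<^sub>R x) (a m *\<^sub>R y))) (0 - e *\<^sub>R 0)"
    by (intro tends_diff tends_scaleR Delta_0)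
  moreover have "b m *\<^sub>R Delta n F (a m *\<^sub>R 2 *\<^sub>R x) (a m *\<^sub>R 2 *\<^sub>R y)
      - e *\<^sub>R (b m *\<^sub>R Delta n F (a m *\<^sub>R x) (a m *\<^sub>R y)) = Delta n (S m) x y" for m
    by (simp add: Delta_def Let_def S_def algebra_simps)
  ultimately show "tends (\<lambda>m. Delta n (S m) x y) 0" by simp
qed

text \<open>Rescaling by \<open>4 ^ m\<close> towards 0 fixes \<open>q\<close> and damps
  \<open>t\<close> by \<open>(1 / 4) ^ m\<close>, so \<open>q\<close> vanishes. Rescaling by
  \<open>(1 / 16) ^ m\<close> towards infinity fixes \<open>t\<close>, which then vanishes as
  well.\<close>

lemma quadratic_quartic_unique:
  fixes q t :: "'a::real_vector \<Rightarrow> 'b"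
  assumes q: "quadratic q" and t: "quartic t"
    and bound: "\<And>x. N (q x + t x) \<le> U x"
    and U_q: "\<And>x. (\<lambda>m. 4 ^ m * U (x /\<^sub>R 2 ^ m)) \<longlonglongrightarrow> 0"
    and U_t: "\<And>x. (\<lambda>m. (1 / 16) ^ m * U (2 ^ m *\<^sub>R x)) \<longlonglongrightarrow> 0"
  shows "q x = 0" and "t x = 0"
proof -
  have q_pow: "q (2 ^ m *\<^sub>R x) = 4 ^ m *\<^sub>R q x" for m x
  proof (induction m)
    case (Suc m)
    then show ?case using quadratic_double[OF q, of "2 ^ m *\<^sub>R x"] by simp
  qed simp
  have t_pow: "t (2 ^ m *\<^sub>R x) = 16 ^ m *\<^sub>R t x" for m x
  proof (induction m)
    case (Suc m)
    then show ?case using quartic_double[OF t, of "2 ^ m *\<^sub>R x"] by simp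
  qed simp
  have q0: "q x = 0" for x
  proof -
    have eq: "4 ^ m *\<^sub>R (q (x /\<^sub>R 2 ^ m) + t (x /\<^sub>R 2 ^ m)) = q x + (1 / 4) ^ m *\<^sub>R t x" for m
    proof -
      have "q x = 4 ^ m *\<^sub>R q (x /\<^sub>R 2 ^ m)" using q_pow[of m "x /\<^sub>R 2 ^ m"] by simp
      moreover have "t x = 16 ^ m *\<^sub>R t (x /\<^sub>R 2 ^ m)" using t_pow[of m "x /\<^sub>R 2 ^ m"] by simp
      moreover have "(1 / 4) ^ m * 16 ^ m = (4::real) ^ m" by (simp flip: power_mult_distrib)
      ultimately show ?thesis by (simp add: scaleR_add_right)
    qed
    have "tends (\<lambda>m. q x + (1 / 4) ^ m *\<^sub>R t x) 0"
      by (rule tends_0I[OF _ U_q[of x]]) (simp add: N_scaleR bound flip: eq)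
    moreover have "tends (\<lambda>m. (1 / 4) ^ m *\<^sub>R t x) 0"
    proof (rule tends_0I)
      show "(\<lambda>m. (1 / 4) ^ m * N (t x)) \<longlonglongrightarrow> 0"
        by (intro tendsto_mult_left_zero LIMSEQ_power_zero) simp
    qed (simp add: N_scaleR)
    ultimately have "tends (\<lambda>m. q x) 0" using tends_diff[of _ 0 _ 0] by fastforce
    then show ?thesis by (simp add: tends_def LIMSEQ_const_iff P_eq_0_iff)
  qed
  then show "q x = 0" .
  have "(1 / 16) ^ m *\<^sub>R t (2 ^ m *\<^sub>R x) = t x" for m
    by (simp add: t_pow flip: power_mult_distrib)
  moreover have "tends (\<lambda>m. (1 / 16) ^ m *\<^sub>R t (2 ^ m *\<^sub>R x)) 0"
    using bound by (intro tends_0I[OF _ U_t[of x]]) (simp add: N_scaleR q0)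
  ultimately have "tends (\<lambda>m. t x) 0" by simp
  then show "t x = 0" by (simp add: tends_def LIMSEQ_const_iff P_eq_0_iff)
qed

lemma P_le_imp_N_le: "P v \<le> c \<Longrightarrow> N v \<le> c powr (1 / p)"
  using powr_mono2[of "1 / p" "P v" c] p_pos by (simp add: P_def powr_powr)

lemma quadratic_part:
  fixes F :: "'a::real_vector \<Rightarrow> 'b"
  assumes n: "n \<noteq> 0" "n \<noteq> 1" "n \<noteq> -1" and F0: "F 0 = 0"
    and F: "\<And>x y. N (Delta n F x y) \<le> \<phi> x y"
    and lim: "\<And>x y. (\<lambda>m. 4 ^ m * \<phi> (x /\<^sub>R 2 ^ m) (y /\<^sub>R 2 ^ m)) \<longlonglongrightarrow> 0"
    and psi: "\<And>x. summable (psi_q_term n p \<phi> x)"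
  obtains Q where "quadratic Q"
    and "\<And>x. N (F (2 *\<^sub>R x) - 16 *\<^sub>R F x - Q x) \<le> psi_q n p \<phi> x powr (1 / p) / 4"
proof -
  define s where "s x m = 4 ^ m *\<^sub>R (F ((2 *\<^sub>R x) /\<^sub>R 2 ^ m) - 16 *\<^sub>R F (x /\<^sub>R 2 ^ m))" for x m
  have inc: "P (s x (Suc m) - s x m) \<le> psi_q_term n p \<phi> x m / 4 powr p" for x m
  proof -
    define z where "z = x /\<^sub>R 2 ^ Suc m"
    have z: "x /\<^sub>R 2 ^ m = 2 *\<^sub>R z" "(2 *\<^sub>R x) /\<^sub>R 2 ^ m = 4 *\<^sub>R z" "(2 *\<^sub>R x) /\<^sub>R 2 ^ Suc m = 2 *\<^sub>R z"
      by (simp_all add: z_def)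
    have "s x (Suc m) - s x m = (- (4 ^ m)) *\<^sub>R dyadic_defect F z"
      unfolding s_def z z_def[symmetric] dyadic_defect_def
      by (rule eq_if_linear_functionals_eq) (simp add: linear_distribs algebra_simps)
    then have "P (s x (Suc m) - s x m) = 4 powr (p * real m) * P (dyadic_defect F z)"
      by (simp only: P_scaleR) (simp add: powr_powr mult.commute flip: powr_realpow)
    also have "\<dots> \<le> 4 powr (p * real m) * Theta n p \<phi> z"
      by (intro mult_left_mono dyadic_defect_le_Theta n F0 F) simp
    \<comment> \<open>At the point \<open>x / 2^(m+1)\<close> the series carries the weight
      \<open>4^(m+1)\<close> but the increment only \<open>4^m\<close>; this offset is the source of
      the factor 1/4 in the final bound.\<close>
    also have "\<dots> = psi_q_term n p \<phi> x m / 4 powr p"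
      unfolding psi_q_term_def z_def[symmetric] by (simp add: distrib_left powr_add)
    finally show ?thesis .
  qed
  have "\<exists>l. tends (s x) l \<and> P (s x 0 - l) \<le> psi_q n p \<phi> x / 4 powr p" for x
    using summable_increments_tends[OF inc summable_divide[OF psi]] suminf_divide[OF psi]
    unfolding psi_q_def by metis
  then obtain Q where Q: "tends (s x) (Q x)" "P (s x 0 - Q x) \<le> psi_q n p \<phi> x / 4 powr p" for x
    by metis
  have "Delta n Q x y = 0" for x y
    by (rule Delta_limit_zero[where b = "\<lambda>m. 4 ^ m" and a = "\<lambda>m. inverse (2 ^ m)" and e = 16, OF F _ lim])
      (use Q(1) in \<open>simp_all only: s_def[abs_def], simp\<close>)
  moreover have "Q (2 *\<^sub>R x) = 4 *\<^sub>R Q x" for x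
  proof (rule tends_unique)
    show "tends (\<lambda>m. s (2 *\<^sub>R x) (Suc m)) (Q (2 *\<^sub>R x))" by (rule tends_Suc[OF Q(1)])
    have "s (2 *\<^sub>R x) (Suc m) = 4 *\<^sub>R s x m" for m by (simp add: s_def mult.commute)
    then show "tends (\<lambda>m. s (2 *\<^sub>R x) (Suc m)) (4 *\<^sub>R Q x)" using tends_scaleR[OF Q(1)] by simp
  qed
  ultimately have "quadratic Q" by (rule Delta_zero_imp_quadratic[OF n])
  moreover have "N (F (2 *\<^sub>R x) - 16 *\<^sub>R F x - Q x) \<le> psi_q n p \<phi> x powr (1 / p) / 4" for x
    using P_le_imp_N_le[OF Q(2)[of x]] p_pos by (simp add: s_def powr_divide powr_powr)
  ultimately show ?thesis by (rule that)
qed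

lemma quartic_part:
  fixes F :: "'a::real_vector \<Rightarrow> 'b"
  assumes n: "n \<noteq> 0" "n \<noteq> 1" "n \<noteq> -1" and F0: "F 0 = 0"
    and F: "\<And>x y. N (Delta n F x y) \<le> \<phi> x y"
    and lim: "\<And>x y. (\<lambda>m. 1 / 16 ^ m * \<phi> (2 ^ m *\<^sub>R x) (2 ^ m *\<^sub>R y)) \<longlonglongrightarrow> 0"
    and psi: "\<And>x. summable (psi_t_term n p \<phi> x)"
  obtains T where "quartic T"
    and "\<And>x. N (F (2 *\<^sub>R x) - 4 *\<^sub>R F x - T x) \<le> psi_t n p \<phi> x powr (1 / p) / 16"
proof -
  define s where "s x m = (1 / 16 ^ m) *\<^sub>R (F (2 ^ m *\<^sub>R 2 *\<^sub>R x) - 4 *\<^sub>R F (2 ^ m *\<^sub>R x))" for x m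
  have inc: "P (s x (Suc m) - s x m) \<le> psi_t_term n p \<phi> x m / 16 powr p" for x m
  proof -
    define z where "z = 2 ^ m *\<^sub>R x"
    have z: "2 ^ m *\<^sub>R 2 *\<^sub>R x = 2 *\<^sub>R z" "2 ^ Suc m *\<^sub>R x = 2 *\<^sub>R z" "2 ^ Suc m *\<^sub>R 2 *\<^sub>R x = 4 *\<^sub>R z"
      by (simp_all add: z_def)
    have "s x (Suc m) - s x m = (1 / 16 ^ Suc m) *\<^sub>R (F (4 *\<^sub>R z) - 4 *\<^sub>R F (2 *\<^sub>R z))
        - (1 / 16 ^ Suc m) *\<^sub>R 16 *\<^sub>R (F (2 *\<^sub>R z) - 4 *\<^sub>R F z)"
      unfolding s_def z z_def[symmetric] by simp
    also have "\<dots> = (1 / 16 ^ Suc m) *\<^sub>R dyadic_defect F z"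
      unfolding scaleR_diff_right[symmetric] dyadic_defect_def
      by (rule arg_cong[where f = "scaleR _"]) (simp add: algebra_simps flip: scaleR_left_distrib)
    finally have "P (s x (Suc m) - s x m) = 1 / 16 powr (p * real m) / 16 powr p * P (dyadic_defect F z)"
      by (simp only: P_scaleR) (simp add: powr_powr powr_divide powr_mult mult.commute flip: powr_realpow)
    also have "\<dots> \<le> 1 / 16 powr (p * real m) / 16 powr p * Theta n p \<phi> z"
      by (intro mult_left_mono dyadic_defect_le_Theta n F0 F) simp
    \<comment> \<open>The increment carries \<open>1 / 16^(m+1)\<close> and the series term
      \<open>1 / 16^m\<close>, whence the factor 1/16 in the final bound.\<close>
    also have "\<dots> = psi_t_term n p \<phi> x m / 16 powr p"
      unfolding psi_t_term_def z_def[symmetric] by simp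
    finally show ?thesis .
  qed
  have "\<exists>l. tends (s x) l \<and> P (s x 0 - l) \<le> psi_t n p \<phi> x / 16 powr p" for x
    using summable_increments_tends[OF inc summable_divide[OF psi]] suminf_divide[OF psi]
    unfolding psi_t_def by metis
  then obtain T where T: "tends (s x) (T x)" "P (s x 0 - T x) \<le> psi_t n p \<phi> x / 16 powr p" for x
    by metis
  have "Delta n T x y = 0" for x y
    by (rule Delta_limit_zero[where b = "\<lambda>m. 1 / 16 ^ m" and a = "\<lambda>m. 2 ^ m" and e = 4, OF F _ lim])
      (use T(1) in \<open>simp_all only: s_def[abs_def], simp\<close>)
  moreover have "T (2 *\<^sub>R x) = 16 *\<^sub>R T x" for x
  proof (rule tends_unique)
    show "tends (s (2 *\<^sub>R x)) (T (2 *\<^sub>R x))" by (rule T(1))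
    have "s (2 *\<^sub>R x) m = 16 *\<^sub>R s x (Suc m)" for m by (simp add: s_def mult.commute)
    then show "tends (s (2 *\<^sub>R x)) (16 *\<^sub>R T x)"
      using tends_scaleR[OF tends_Suc[OF T(1)[of x]], of 16] by presburger
  qed
  ultimately have "quartic T" by (rule Delta_zero_imp_quartic[OF n])
  moreover have "N (F (2 *\<^sub>R x) - 4 *\<^sub>R F x - T x) \<le> psi_t n p \<phi> x powr (1 / p) / 16" for x
    using P_le_imp_N_le[OF T(2)[of x]] p_pos by (simp add: s_def powr_divide powr_powr)
  ultimately show ?thesis by (rule that)
qed

end

theorem theorem3p10:
  fixes n :: int and p :: real
    and NX :: "'x::real_vector \<Rightarrow> real"
    and NY :: "'y::real_vector \<Rightarrow> real"
    and \<phi> :: "'x \<Rightarrow> 'x \<Rightarrow> real"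
    and f :: "'x \<Rightarrow> 'y"
  assumes n: "n \<noteq> 0" "n \<noteq> 1" "n \<noteq> -1"
    and p: "0 < p" "p \<le> 1"
    and X: "quasi_Banach NX"
    and Y: "p_Banach p NY"
    and phi_nonneg: "\<And>x y. \<phi> x y \<ge> 0"
    and lim_q: "\<And>x y. (\<lambda>m. 4 ^ m * \<phi> (x /\<^sub>R 2 ^ m) (y /\<^sub>R 2 ^ m)) \<longlonglongrightarrow> 0"
    and lim_t: "\<And>x y. (\<lambda>m. 1 / 16 ^ m * \<phi> (2 ^ m *\<^sub>R x) (2 ^ m *\<^sub>R y)) \<longlonglongrightarrow> 0"
    and sum_q: "\<And>x y. y \<in> test_points n x \<Longrightarrow>
      summable (\<lambda>i. 4 powr (p * real (Suc i)) * \<phi> (x /\<^sub>R 2 ^ Suc i) (y /\<^sub>R 2 ^ Suc i) powr p)"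
    and sum_t: "\<And>x y. y \<in> test_points n x \<Longrightarrow>
      summable (\<lambda>i. 1 / 16 powr (p * real i) * \<phi> (2 ^ i *\<^sub>R x) (2 ^ i *\<^sub>R y) powr p)"
    and psi_q_converges: "\<And>x. summable (psi_q_term n p \<phi> x)"
    and psi_t_converges: "\<And>x. summable (psi_t_term n p \<phi> x)"
    and f0: "f 0 = 0"
    and f_approx: "\<And>x y. NY (Delta n f x y) \<le> \<phi> x y"
  shows "\<exists>!QT. case QT of (Q, T) \<Rightarrow>
    quadratic Q \<and> quartic T \<and>
    (\<forall>x. NY (f x - Q x - T x) \<le>
       modulus_of_concavity NY ^ 9 / 192 *
         (4 * psi_q n p \<phi> x powr (1 / p) + psi_t n p \<phi> x powr (1 / p)))"
proof -
  interpret Y: p_Banach_space NY p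
    by unfold_locales (fact Y, fact p(1))
  define M where "M = modulus_of_concavity NY"
  define U where "U x = M ^ 9 / 192 * (4 * psi_q n p \<phi> x powr (1 / p) + psi_t n p \<phi> x powr (1 / p))" for x
  have M: "1 \<le> M" "M \<le> M ^ 9"
    using Y.modulus_of_concavity_ge_1 self_le_power[of M 9] by (simp_all add: M_def)
  obtain Q where Q: "quadratic Q"
    and Q_le: "\<And>x. NY (f (2 *\<^sub>R x) - 16 *\<^sub>R f x - Q x) \<le> psi_q n p \<phi> x powr (1 / p) / 4"
    using Y.quadratic_part[OF n f0 f_approx lim_q psi_q_converges] by blast
  obtain T where T: "quartic T"
    and T_le: "\<And>x. NY (f (2 *\<^sub>R x) - 4 *\<^sub>R f x - T x) \<le> psi_t n p \<phi> x powr (1 / p) / 16"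
    using Y.quartic_part[OF n f0 f_approx lim_t psi_t_converges] by blast
  \<comment> \<open>The weights come from \<open>12 f = h - g\<close>. The constants combine to 1/12
    * 1/16 = 1/192 for the quartic part and 1/12 * 1/4 = 4/192 for the quadratic part; concavity
    costs a factor \<open>M\<close>, and \<open>M \<le> M ^ 9\<close>.\<close>
  have existence: "NY (f x - (- 1 / 12) *\<^sub>R Q x - (1 / 12) *\<^sub>R T x) \<le> U x" for x
  proof -
    let ?u = "f (2 *\<^sub>R x) - 4 *\<^sub>R f x - T x" and ?v = "f (2 *\<^sub>R x) - 16 *\<^sub>R f x - Q x"
    have "f x - (- 1 / 12) *\<^sub>R Q x - (1 / 12) *\<^sub>R T x = (1 / 12) *\<^sub>R ?u + (- 1 / 12) *\<^sub>R ?v"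
      by (rule eq_if_linear_functionals_eq) (simp add: linear_distribs algebra_simps)
    then have "NY (f x - (- 1 / 12) *\<^sub>R Q x - (1 / 12) *\<^sub>R T x)
        \<le> M * (NY ((1 / 12) *\<^sub>R ?u) + NY ((- 1 / 12) *\<^sub>R ?v))"
      unfolding M_def by (metis Y.N_concavity)
    also have "\<dots> = M * (NY ?u / 12 + NY ?v / 12)" by (simp only: Y.N_scaleR) simp
    also have "\<dots> \<le> M * (psi_t n p \<phi> x powr (1 / p) / 16 / 12 + psi_q n p \<phi> x powr (1 / p) / 4 / 12)"
      using M(1) by (intro mult_left_mono add_mono divide_right_mono Q_le T_le) simp_all
    also have "\<dots> \<le> M ^ 9 * (psi_t n p \<phi> x powr (1 / p) / 16 / 12 + psi_q n p \<phi> x powr (1 / p) / 4 / 12)"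
      by (intro mult_right_mono M) simp
    also have "\<dots> = U x" by (simp add: U_def algebra_simps)
    finally show ?thesis .
  qed
  \<comment> \<open>The factor \<open>2 * M\<close> is there because \<open>2 * M * U\<close> bounds
    the difference of two solutions.\<close>
  have U_q: "(\<lambda>m. 4 ^ m * (2 * M * U (x /\<^sub>R 2 ^ m))) \<longlonglongrightarrow> 0" for x
  proof -
    have "(\<lambda>m. 2 * M * (M ^ 9 / 192) * (4 * (4 ^ m * psi_q n p \<phi> (x /\<^sub>R 2 ^ m) powr (1 / p))
        + 4 ^ m * psi_t n p \<phi> (x /\<^sub>R 2 ^ m) powr (1 / p))) \<longlonglongrightarrow> 0"
      by (intro tendsto_mult_right_zero tendsto_add_zero psi_rescaled_tendsto_0 p psi_q_converges psi_t_converges)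
    then show ?thesis by (simp add: U_def algebra_simps)
  qed
  have U_t: "(\<lambda>m. (1 / 16) ^ m * (2 * M * U (2 ^ m *\<^sub>R x))) \<longlonglongrightarrow> 0" for x
  proof -
    have "(\<lambda>m. 2 * M * (M ^ 9 / 192) * (4 * ((1 / 16) ^ m * psi_q n p \<phi> (2 ^ m *\<^sub>R x) powr (1 / p))
        + (1 / 16) ^ m * psi_t n p \<phi> (2 ^ m *\<^sub>R x) powr (1 / p))) \<longlonglongrightarrow> 0"
      by (intro tendsto_mult_right_zero tendsto_add_zero psi_rescaled_tendsto_0 p psi_q_converges psi_t_converges)
    then show ?thesis by (simp add: U_def algebra_simps)
  qed
  have uniqueness: "Q1 = Q2 \<and> T1 = T2"
    if Q1: "quadratic Q1" and T1: "quartic T1" and b1: "\<And>x. NY (f x - Q1 x - T1 x) \<le> U x"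
      and Q2: "quadratic Q2" and T2: "quartic T2" and b2: "\<And>x. NY (f x - Q2 x - T2 x) \<le> U x"
    for Q1 Q2 :: "'x \<Rightarrow> 'y" and T1 T2 :: "'x \<Rightarrow> 'y"
  proof -
    have bound: "NY ((Q1 x - Q2 x) + (T1 x - T2 x)) \<le> 2 * M * U x" for x
    proof -
      have "(Q1 x - Q2 x) + (T1 x - T2 x) = (f x - Q2 x - T2 x) + (- 1) *\<^sub>R (f x - Q1 x - T1 x)"
        by simp
      then have "NY ((Q1 x - Q2 x) + (T1 x - T2 x)) \<le> M * (NY (f x - Q2 x - T2 x) + NY ((- 1) *\<^sub>R (f x - Q1 x - T1 x)))"
        unfolding M_def by (metis Y.N_concavity)
      also have "\<dots> = M * (NY (f x - Q2 x - T2 x) + NY (f x - Q1 x - T1 x))"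
        by (simp only: Y.N_scaleR) simp
      also have "\<dots> \<le> M * (U x + U x)"
        using M(1) by (intro mult_left_mono add_mono b1 b2) simp
      finally show ?thesis by simp
    qed
    note zero = Y.quadratic_quartic_unique[OF quadratic_diff[OF Q1 Q2] quartic_diff[OF T1 T2] bound U_q U_t]
    show ?thesis using zero by (simp add: fun_eq_iff)
  qed
  show ?thesis
    unfolding M_def[symmetric] U_def[symmetric]
  proof (rule ex1I)
    show "case (\<lambda>x. (- 1 / 12) *\<^sub>R Q x, \<lambda>x. (1 / 12) *\<^sub>R T x) of
        (Q, T) \<Rightarrow> quadratic Q \<and> quartic T \<and> (\<forall>x. NY (f x - Q x - T x) \<le> U x)"
      unfolding prod.case by (intro conjI allI quadratic_scaleR Q quartic_scaleR T existence)
  next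
    fix QT :: "('x \<Rightarrow> 'y) \<times> ('x \<Rightarrow> 'y)"
    assume "case QT of (Q, T) \<Rightarrow> quadratic Q \<and> quartic T \<and> (\<forall>x. NY (f x - Q x - T x) \<le> U x)"
    then show "QT = (\<lambda>x. (- 1 / 12) *\<^sub>R Q x, \<lambda>x. (1 / 12) *\<^sub>R T x)"
      using uniqueness[OF _ _ _ quadratic_scaleR[OF Q] quartic_scaleR[OF T] existence]
      by (cases QT) (simp only: prod.case prod.inject, blast)
  qed
qed

end
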